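(* For every integer $n\ge1$, $$2^{n-1}=\sum_{i=1}^n\Theta(n,i)\,i!\qquad\text{and}\qquad n!=\sum_{i=1}^n\theta(n,i)\,2^{i-1}.$$
   Context: For integers $n,m\ge0$, the tanh numbers $\theta(n,m)$ and $\Theta(n,m)$ are defined by $\sum_n\theta(n,m)\frac{u^n}{n!}=\frac1{m!}(\operatorname{artanh}u)^m$ and $\sum_n\Theta(n,m)\frac{u^n}{n!}=\frac1{m!}\tanh^m u$. *)

theory Defs
  imports "HOL-Complex_Analysis.Complex_Analysis"
begin

(* The numbers are integers; they are complex-valued here because fps_expansion, the
   Taylor series of a function at a point, is defined for complex functions. *)

definition theta :: "nat \<Rightarrow> nat \<Rightarrow> complex" where
  "theta n m = fact n * fps_nth (fps_expansion (\<lambda>u. 1 / fact m * artanh u ^ m) 0) n"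

definition Theta :: "nat \<Rightarrow> nat \<Rightarrow> complex" where
  "Theta n m = fact n * fps_nth (fps_expansion (\<lambda>u. 1 / fact m * tanh u ^ m) 0) n"

lemma artanh_holomorphic: "(artanh :: complex \<Rightarrow> complex) holomorphic_on ball 0 1"
proof -
  have "(1 + u) / (1 - u) \<notin> \<real>\<^sub>\<le>\<^sub>0 \<and> 1 - u \<noteq> 0" if "u \<in> ball 0 1" for u :: complex
  proof
    have norm: "norm u < 1" using that by simp
    show nz: "1 - u \<noteq> 0" using norm by auto
    show "(1 + u) / (1 - u) \<notin> \<real>\<^sub>\<le>\<^sub>0"
    proof
      assume "(1 + u) / (1 - u) \<in> \<real>\<^sub>\<le>\<^sub>0"
      then obtain r where r: "(1 + u) / (1 - u) = of_real r" "r \<le> 0"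
        by (auto elim: nonpos_Reals_cases)
      then have "1 + u = of_real r * (1 - u)"
        using nz by (simp add: field_simps)
      then have "u * of_real (1 + r) = of_real (r - 1)"
        by (simp add: algebra_simps)
      then have "norm u * \<bar>1 + r\<bar> = \<bar>r - 1\<bar>"
        by (metis norm_mult norm_of_real)
      moreover have "norm u * \<bar>1 + r\<bar> \<le> 1 * \<bar>1 + r\<bar>"
        using norm by (intro mult_right_mono) auto
      ultimately have "r = 0" "norm u = 1"
        using r(2) by (auto simp: abs_if split: if_splits)
      then show False using norm by simp
    qed
  qed
  then show ?thesis
    unfolding artanh_def [abs_def] by (intro holomorphic_intros) auto
qed

lemma tanh_holomorphic: "\<exists>s. open s \<and> (0::complex) \<in> s \<and> tanh holomorphic_on s"
proof (intro exI conjI)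
  let ?s = "cosh -` (- {0}) :: complex set"
  show "open ?s"
    by (intro open_vimage) (auto intro!: continuous_intros)
  show "(0::complex) \<in> ?s" by simp
  show "(tanh :: complex \<Rightarrow> complex) holomorphic_on ?s"
    unfolding tanh_def [abs_def] sinh_def [abs_def]
    by (intro holomorphic_intros) (auto simp: cosh_def intro!: holomorphic_intros)
qed

theorem theta_egf:
  "(\<lambda>u. 1 / fact m * artanh u ^ m) has_fps_expansion Abs_fps (\<lambda>n. theta n m / fact n)"
proof -
  have "(\<lambda>u. 1 / fact m * artanh u ^ m) has_fps_expansion
          fps_expansion (\<lambda>u::complex. 1 / fact m * artanh u ^ m) 0"
    by (rule has_fps_expansion_fps_expansion[of "ball 0 1"])
       (auto intro!: holomorphic_intros artanh_holomorphic)
  then show ?thesis by (simp add: theta_def fps_nth_inverse)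
qed

theorem Theta_egf:
  "(\<lambda>u. 1 / fact m * tanh u ^ m) has_fps_expansion Abs_fps (\<lambda>n. Theta n m / fact n)"
proof -
  obtain s where s: "open s" "(0::complex) \<in> s" "tanh holomorphic_on s"
    using tanh_holomorphic by blast
  have "(\<lambda>u. 1 / fact m * tanh u ^ m) has_fps_expansion
          fps_expansion (\<lambda>u::complex. 1 / fact m * tanh u ^ m) 0"
    by (rule has_fps_expansion_fps_expansion[of s])
       (use s in \<open>auto intro!: holomorphic_intros\<close>)
  then show ?thesis by (simp add: Theta_def fps_nth_inverse)
qed

end

theory Submission
  imports Defs
begin

text \<open>
  Both identities are Taylor coefficients of the single relation
  \<open>1 / (1 - tanh x) = (1 + exp (2 * x)) / 2\<close>, or equivalently near \<open>0\<close>, with \<open>u = tanh x\<close>,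
  \<open>1 / (1 - u) = (1 + exp (2 * artanh u)) / 2\<close>.

  The numbers \<open>\<Theta>(n,i)\<close> and \<open>\<theta>(n,i)\<close> govern composition with \<open>tanh\<close> and \<open>artanh\<close>: if
  \<open>g x = (\<Sum>i. c i * x ^ i / fact i)\<close>, then the coefficient of \<open>u ^ n / fact n\<close> in
  \<open>g (tanh u)\<close> is \<open>(\<Sum>i=1..n. \<Theta>(n,i) * c i)\<close> for \<open>n \<ge> 1\<close>, and likewise for \<open>artanh\<close> and \<open>\<theta>\<close>
  (lemma \<open>compose_coefficients\<close>). The function \<open>1 / (1 - x)\<close> has \<open>c i = fact i\<close>, and
  \<open>(1 + exp (2 * x)) / 2\<close> has \<open>c i = 2 ^ (i - 1)\<close> for \<open>i \<ge> 1\<close>. By the relation above,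
  composition with \<open>tanh\<close> carries the first function to the second, which is the first identity;
  composition with \<open>artanh\<close> carries the second to the first, which is the second identity.
\<close>

text \<open>
  Comparing Taylor coefficients gives \<open>a n i = fact n / fact i\<close> times the \<open>n\<close>-th coefficient of
  \<open>F ^ i\<close>, where \<open>F\<close> is the expansion of \<open>f\<close>; these powers make up the coefficients of the
  formal composition of \<open>G\<close> with \<open>F\<close>. The power \<open>F ^ 0 = 1\<close> contributes only to degree \<open>0\<close>,
  so for \<open>n \<ge> 1\<close> the sum starts at \<open>1\<close>.
\<close>
lemma compose_coefficients:
  fixes f g h :: "complex \<Rightarrow> complex" and a :: "nat \<Rightarrow> nat \<Rightarrow> complex"
  assumes a: "\<And>m. (\<lambda>u. 1 / fact m * f u ^ m) has_fps_expansion Abs_fps (\<lambda>n. a n m / fact n)"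
    and f0: "f 0 = 0"
    and g: "g has_fps_expansion G"
    and h: "h has_fps_expansion H"
    and gf: "eventually (\<lambda>u. g (f u) = h u) (nhds 0)"
    and n: "n \<ge> 1"
  shows "(\<Sum>i=1..n. a n i * (fact i * fps_nth G i)) = fact n * fps_nth H n"
proof -
  define F where "F = Abs_fps (\<lambda>n. a n 1 / fact n)"
  have F: "f has_fps_expansion F"
    using a[of 1] by (simp add: F_def)
  have F0: "fps_nth F 0 = 0"
    using has_fps_expansion_imp_0_eq_fps_nth_0[OF F] f0 by simp
  have Fpow: "fps_nth (F ^ i) n = fact i * (a n i / fact n)" for i
  proof -
    have "(\<lambda>u. 1 / fact i * f u ^ i) has_fps_expansion fps_const (1 / fact i) * F ^ i"
      by (intro fps_expansion_intros F)
    then have "Abs_fps (\<lambda>n. a n i / fact n) = fps_const (1 / fact i) * F ^ i"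
      by (rule fps_expansion_unique_complex[OF a])
    from arg_cong[OF this, of "\<lambda>P. fps_nth P n"] show ?thesis
      by (simp add: field_simps)
  qed
  have "(g \<circ> f) has_fps_expansion fps_compose G F"
    using g F F0 by (rule has_fps_expansion_compose)
  moreover have "(g \<circ> f) has_fps_expansion H"
    using h gf by (subst has_fps_expansion_cong[of _ h]) simp_all
  ultimately have "H = fps_compose G F"
    using fps_expansion_unique_complex by blast
  then have "fps_nth H n = (\<Sum>i=0..n. fps_nth G i * fps_nth (F ^ i) n)"
    by (simp add: fps_compose_nth)
  also have "\<dots> = (\<Sum>i=1..n. fps_nth G i * fps_nth (F ^ i) n)"
    using n by (simp add: sum.atLeast_Suc_atMost)
  finally show ?thesis
    by (simp add: Fpow sum_distrib_left algebra_simps)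
qed

lemma has_fps_expansion_geometric:
  "(\<lambda>x::complex. 1 / (1 - x)) has_fps_expansion Abs_fps (\<lambda>_. 1)"
proof -
  have "(\<lambda>x::complex. inverse (1 - x)) has_fps_expansion inverse (1 - fps_X)"
    by (intro fps_expansion_intros) simp
  then show ?thesis
    by (simp add: fps_inverse_one_minus_fps_X inverse_eq_divide)
qed

lemma has_fps_expansion_half_one_plus_exp:
  "(\<lambda>x::complex. 1 / 2 * (1 + exp (2 * x))) has_fps_expansion
     fps_const (1 / 2) * (1 + fps_exp 2)"
  by (intro fps_expansion_intros)

lemma fps_nth_half_one_plus_exp:
  assumes "n \<ge> 1"
  shows "fact n * fps_nth (fps_const (1 / 2) * (1 + fps_exp (2::complex))) n = 2 ^ (n - 1)"
  using assms by (cases n) (simp_all del: fact_Suc)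

lemma geometric_tanh:
  fixes x :: complex
  assumes "cosh x \<noteq> 0"
  shows "1 / (1 - tanh x) = 1 / 2 * (1 + exp (2 * x))"
proof -
  have "1 - tanh x = exp (- x) / cosh x"
    using assms by (simp add: tanh_def field_simps flip: cosh_minus_sinh)
  then have "1 / (1 - tanh x) = cosh x * exp x"
    by (simp only: exp_minus divide_inverse inverse_mult_distrib inverse_inverse_eq mult_ac mult_1_left)
  also have "\<dots> = 1 / 2 * (1 + exp (2 * x))"
    by (simp add: cosh_field_def field_simps flip: exp_add)
  finally show ?thesis .
qed

lemma half_one_plus_exp_artanh:
  fixes u :: complex
  assumes "u \<noteq> 1" "u \<noteq> - 1"
  shows "1 / 2 * (1 + exp (2 * artanh u)) = 1 / (1 - u)"
proof -
  have "1 + u \<noteq> 0"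
    using assms(2) by (metis add_eq_0_iff)
  then have "exp (2 * artanh u) = (1 + u) / (1 - u)"
    using assms(1) by (simp add: artanh_def)
  then show ?thesis
    using assms(1) by (simp add: field_simps)
qed

theorem mainTheorem8:
  fixes n :: nat
  assumes "n \<ge> 1"
  shows "2 ^ (n - 1) = (\<Sum>i=1..n. Theta n i * fact i) \<and>
         fact n = (\<Sum>i=1..n. theta n i * 2 ^ (i - 1))"
proof
  have "open (cosh -` (- {0}) :: complex set)"
    by (intro open_vimage) (auto intro!: continuous_intros)
  then have "eventually (\<lambda>x::complex. x \<in> cosh -` (- {0})) (nhds 0)"
    by (rule eventually_nhds_in_open) simp
  then have "eventually (\<lambda>x::complex. 1 / (1 - tanh x) = 1 / 2 * (1 + exp (2 * x))) (nhds 0)"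
    by eventually_elim (rule geometric_tanh; simp)
  from compose_coefficients[OF Theta_egf tanh_0 has_fps_expansion_geometric
      has_fps_expansion_half_one_plus_exp this assms]
  show "2 ^ (n - 1) = (\<Sum>i=1..n. Theta n i * fact i)"
    by (simp only: fps_nth_half_one_plus_exp[OF assms]) simp
next
  have "eventually (\<lambda>u::complex. u \<in> - {1, - 1}) (nhds 0)"
    by (intro eventually_nhds_in_open) auto
  then have "eventually (\<lambda>u::complex. 1 / 2 * (1 + exp (2 * artanh u)) = 1 / (1 - u)) (nhds 0)"
    by eventually_elim (rule half_one_plus_exp_artanh; simp)
  from compose_coefficients[OF theta_egf artanh_0 has_fps_expansion_half_one_plus_exp
      has_fps_expansion_geometric this assms]
  have "fact n = (\<Sum>i=1..n. theta n i *
      (fact i * fps_nth (fps_const (1 / 2) * (1 + fps_exp (2::complex))) i))"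
    by simp
  also have "\<dots> = (\<Sum>i=1..n. theta n i * 2 ^ (i - 1))"
    by (intro sum.cong refl) (simp only: fps_nth_half_one_plus_exp atLeastAtMost_iff)
  finally show "fact n = (\<Sum>i=1..n. theta n i * 2 ^ (i - 1))" .
qed

end
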